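(* Let $S$ be a reduced information semialgebra and let $n\ge 2$ be an integer. If $U_n(S)$ is a BFM, then $U_n(S)$ satisfies the ACCP.
   Context: All monoids are cancellative but not necessarily commutative. An information semialgebra is a semiring $S$ with $0$ and $1$ (so $(S,+)$ is a commutative monoid with identity $0$, multiplication has identity $1$ and distributes over addition, and $0\cdot x=0$ for all $x$) such that $(S,+)$ is a cancellative commutative monoid whose only invertible element is $0$, and $(S\setminus\{0\},\cdot)$ is a cancellative commutative monoid. $S$ is reduced if $1$ is the only invertible element of $(S\setminus\{0\},\cdot)$. $U_n(S)$ is the multiplicative monoid of $n\times n$ upper triangular matrices over $S$ all of whose diagonal entries equal $1$. In a monoid $M$, an atom is a non-invertible $a$ such that $a=uv$ implies that $u$ or $v$ is invertible; $M$ is atomic if each non-invertible element is a finite product of atoms. A length of a non-invertible $x$ is a number $\ell\ge1$ with $x=a_1\cdots a_\ell$ for atoms $a_i$; $\mathsf L(x)$ is the set of lengths of $x$, and $\mathsf L(u)=\{0\}$ for invertible $u$. $M$ is a BFM if it is atomic and $\mathsf L(x)$ is finite for every $x\in M$. $M$ satisfies the ACCP if every ascending chain of principal left ideals $Mx$ stabilizes and every ascending chain of principal right ideals $xM$ stabilizes. *)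

theory Defs
  imports "Jordan_Normal_Form.Matrix" "HOL-Algebra.Divisibility" "HOL-Algebra.Coset"
begin

(* S is the whole type 'a. Commutativity of multiplication, required only on S - {0}, extends to
   all of S because 0 * x = 0 and, by distributivity and additive cancellation, x * 0 = 0.
   That S - {0} is a monoid with identity 1 gives 0 ~= 1 and the absence of zero divisors;
   both are part of the library classes below, as is multiplicative cancellation by nonzero
   elements. cancel_semigroup_add is used since cancel_ab_semigroup_add comes with a
   subtraction satisfying further axioms. *)
class information_semialgebra =
  comm_semiring_1 + cancel_semigroup_add + semiring_no_zero_divisors_cancel +
  assumes add_invertible_imp_zero: "a + b = 0 \<Longrightarrow> a = 0"

(* A multiplicative inverse of a in S is automatically nonzero since 0 ~= 1. *)
class reduced_information_semialgebra = information_semialgebra +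
  assumes mult_invertible_imp_one: "a * b = 1 \<Longrightarrow> a = 1"

instance nat :: reduced_information_semialgebra
  by standard auto

definition unitriangular_monoid :: "nat \<Rightarrow> 'a::semiring_1 mat monoid" where
  "unitriangular_monoid n =
    \<lparr> carrier = {A \<in> carrier_mat n n. upper_triangular A \<and> (\<forall>i<n. A $$ (i,i) = 1)},
      mult = (*), one = 1\<^sub>m n \<rparr>"

lemma unitriangular_times_index:
  assumes "A \<in> carrier (unitriangular_monoid n)" "B \<in> carrier (unitriangular_monoid n)"
    "i < n" "j < n"
  shows "(A * B) $$ (i,j) = B $$ (i,j) + (\<Sum>k\<in>{i<..<n}. A $$ (i,k) * B $$ (k,j))"
    and "(A * B) $$ (i,j) = A $$ (i,j) + (\<Sum>k<j. A $$ (i,k) * B $$ (k,j))"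
proof -
  have carr: "A \<in> carrier_mat n n" "B \<in> carrier_mat n n"
    and diag: "A $$ (i,i) = 1" "B $$ (j,j) = 1"
    and low: "\<And>k. k < i \<Longrightarrow> A $$ (i,k) = 0" "\<And>k. j < k \<Longrightarrow> k < n \<Longrightarrow> B $$ (k,j) = 0"
    using assms by (auto simp: unitriangular_monoid_def)
  have eq: "(A * B) $$ (i,j) = (\<Sum>k<n. A $$ (i,k) * B $$ (k,j))"
    using carr assms(3,4) by (auto simp: scalar_prod_def atLeast0LessThan)
  also have "\<dots> = (\<Sum>k\<in>insert i {i<..<n}. A $$ (i,k) * B $$ (k,j))"
    using assms(3) low(1) by (intro sum.mono_neutral_right) (auto simp: not_less, metis mult_zero_left nat_less_le)
  also have "\<dots> = B $$ (i,j) + (\<Sum>k\<in>{i<..<n}. A $$ (i,k) * B $$ (k,j))"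
    by (simp add: diag)
  finally show "(A * B) $$ (i,j) = B $$ (i,j) + (\<Sum>k\<in>{i<..<n}. A $$ (i,k) * B $$ (k,j))" .
  note eq
  also have "(\<Sum>k<n. A $$ (i,k) * B $$ (k,j)) = (\<Sum>k\<in>insert j {..<j}. A $$ (i,k) * B $$ (k,j))"
    using assms(4) low(2) by (intro sum.mono_neutral_right) auto
  also have "\<dots> = A $$ (i,j) + (\<Sum>k<j. A $$ (i,k) * B $$ (k,j))"
    by (simp add: diag)
  finally show "(A * B) $$ (i,j) = A $$ (i,j) + (\<Sum>k<j. A $$ (i,k) * B $$ (k,j))" .
qed

lemma monoid_unitriangular: "monoid (unitriangular_monoid n :: 'a::semiring_1 mat monoid)"
    (is "monoid ?U")
proof (rule monoidI)
  fix A B C :: "'a mat"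
  assume A: "A \<in> carrier ?U" and B: "B \<in> carrier ?U"
  have zero: "(A * B) $$ (i,j) = 0" if "j < i" "i < n" for i j
  proof -
    have "B $$ (k,j) = 0" if "i \<le> k" "k < n" for k
      using B \<open>j < i\<close> that by (auto simp: unitriangular_monoid_def)
    then show ?thesis
      using unitriangular_times_index(1)[OF A B \<open>i < n\<close>, of j] that by simp
  qed
  have one: "(A * B) $$ (i,i) = 1" if "i < n" for i
  proof -
    have "B $$ (i,i) = 1" "\<And>k. i < k \<Longrightarrow> k < n \<Longrightarrow> B $$ (k,i) = 0"
      using B that by (auto simp: unitriangular_monoid_def)
    then show ?thesis
      using unitriangular_times_index(1)[OF A B that that] by simp
  qed
  show "A \<otimes>\<^bsub>?U\<^esub> B \<in> carrier ?U"
    using A B zero one by (auto simp: unitriangular_monoid_def)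
  assume "C \<in> carrier ?U"
  with A B show "A \<otimes>\<^bsub>?U\<^esub> B \<otimes>\<^bsub>?U\<^esub> C = A \<otimes>\<^bsub>?U\<^esub> (B \<otimes>\<^bsub>?U\<^esub> C)"
    by (auto simp: unitriangular_monoid_def intro: assoc_mult_mat)
qed (auto simp: unitriangular_monoid_def)

(* All monoids under consideration are cancellative; for this one it is a consequence of the
   axioms on S, so the predicates below need not ask for it. *)
lemma monoid_cancel_unitriangular:
  "monoid_cancel (unitriangular_monoid n :: 'a::information_semialgebra mat monoid)"
    (is "monoid_cancel ?U")
proof (rule monoid.monoid_cancelI[OF monoid_unitriangular])
  fix A B C :: "'a mat"
  assume "C \<otimes>\<^bsub>?U\<^esub> A = C \<otimes>\<^bsub>?U\<^esub> B" and A: "A \<in> carrier ?U" and B: "B \<in> carrier ?U"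
    and C: "C \<in> carrier ?U"
  then have eq: "C * A = C * B" by (simp add: unitriangular_monoid_def)
  have "A $$ (i,j) = B $$ (i,j)" if "i < n" "j < n" for i j
    using that(1)
  proof (induction "n - i" arbitrary: i rule: less_induct)
    case less
    have "A $$ (k,j) = B $$ (k,j)" if "k \<in> {i<..<n}" for k
      using less that by auto
    then have "(\<Sum>k\<in>{i<..<n}. C $$ (i,k) * A $$ (k,j)) = (\<Sum>k\<in>{i<..<n}. C $$ (i,k) * B $$ (k,j))"
      by simp
    then show ?case
      using unitriangular_times_index(1)[OF C A less.prems that(2)]
        unitriangular_times_index(1)[OF C B less.prems that(2)] eq by simp
  qed
  then show "A = B"
    using A B by (intro eq_matI) (auto simp: unitriangular_monoid_def)
next
  fix A B C :: "'a mat"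
  assume "A \<otimes>\<^bsub>?U\<^esub> C = B \<otimes>\<^bsub>?U\<^esub> C" and A: "A \<in> carrier ?U" and B: "B \<in> carrier ?U"
    and C: "C \<in> carrier ?U"
  then have eq: "A * C = B * C" by (simp add: unitriangular_monoid_def)
  have "A $$ (i,j) = B $$ (i,j)" if "i < n" "j < n" for i j
    using that(2)
  proof (induction j rule: less_induct)
    case (less j)
    have "(\<Sum>k<j. A $$ (i,k) * C $$ (k,j)) = (\<Sum>k<j. B $$ (i,k) * C $$ (k,j))"
      using less by simp
    then show ?case
      using unitriangular_times_index(2)[OF A C that(1) less.prems]
        unitriangular_times_index(2)[OF B C that(1) less.prems] eq by simp
  qed
  then show "A = B"
    using A B by (intro eq_matI) (auto simp: unitriangular_monoid_def)
qed

(* The library's irreducible and factorisation predicates in HOL-Algebra.Divisibility rely on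
   one-sided divisibility and are meant for commutative monoids, so the two-sided notions are
   defined here. *)
definition atom :: "('m, 'r) monoid_scheme \<Rightarrow> 'm \<Rightarrow> bool" where
  "atom M a \<longleftrightarrow> a \<in> carrier M - Units M \<and>
    (\<forall>u\<in>carrier M. \<forall>v\<in>carrier M. a = u \<otimes>\<^bsub>M\<^esub> v \<longrightarrow> u \<in> Units M \<or> v \<in> Units M)"

definition atom_factorization :: "('m, 'r) monoid_scheme \<Rightarrow> 'm list \<Rightarrow> 'm \<Rightarrow> bool" where
  "atom_factorization M as x \<longleftrightarrow>
    as \<noteq> [] \<and> (\<forall>a\<in>set as. atom M a) \<and> foldr (\<otimes>\<^bsub>M\<^esub>) as \<one>\<^bsub>M\<^esub> = x"

definition atomic_monoid :: "('m, 'r) monoid_scheme \<Rightarrow> bool" where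
  "atomic_monoid M \<longleftrightarrow> (\<forall>x\<in>carrier M - Units M. \<exists>as. atom_factorization M as x)"

definition lengths :: "('m, 'r) monoid_scheme \<Rightarrow> 'm \<Rightarrow> nat set" where
  "lengths M x = (if x \<in> Units M then {0} else {length as | as. atom_factorization M as x})"

definition BFM :: "('m, 'r) monoid_scheme \<Rightarrow> bool" where
  "BFM M \<longleftrightarrow> atomic_monoid M \<and> (\<forall>x\<in>carrier M. finite (lengths M x))"

(* carrier M #> x is the principal left ideal M x, and x <# carrier M is the principal
   right ideal x M. *)
definition ACCP :: "('m, 'r) monoid_scheme \<Rightarrow> bool" where
  "ACCP M \<longleftrightarrow>
    (\<forall>x::nat \<Rightarrow> 'm. (\<forall>k. x k \<in> carrier M) \<longrightarrow>
      (\<forall>k. carrier M #>\<^bsub>M\<^esub> x k \<subseteq> carrier M #>\<^bsub>M\<^esub> x (Suc k)) \<longrightarrow>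
      (\<exists>N. \<forall>k\<ge>N. carrier M #>\<^bsub>M\<^esub> x k = carrier M #>\<^bsub>M\<^esub> x N)) \<and>
    (\<forall>x::nat \<Rightarrow> 'm. (\<forall>k. x k \<in> carrier M) \<longrightarrow>
      (\<forall>k. x k <#\<^bsub>M\<^esub> carrier M \<subseteq> x (Suc k) <#\<^bsub>M\<^esub> carrier M) \<longrightarrow>
      (\<exists>N. \<forall>k\<ge>N. x k <#\<^bsub>M\<^esub> carrier M = x N <#\<^bsub>M\<^esub> carrier M))"

end

theory Submission
  imports Defs
begin

text \<open>In a cancellative BFM, multiplying by a non-unit strictly increases the maximal
  factorization length. Along an ascending chain of principal one-sided ideals this length attains
  a minimum at some generator \<open>x N\<close>; for \<open>k \<ge> N\<close> the cofactor of \<open>x k\<close> in \<open>x N\<close> is then a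
  unit, so the two ideals coincide.\<close>

text \<open>Without commutativity, \<open>y\<close> times the inverse of
  \<open>x \<otimes> y\<close> is at first only a right inverse \<open>z\<close> of
  \<open>x\<close>. Left cancellation in \<open>x \<otimes> (z \<otimes> x) = x\<close> makes it
  two-sided, and then \<open>y\<close> is a unit as well.\<close>

lemma (in monoid_cancel) Units_mult_iff:
  assumes x: "x \<in> carrier G" and y: "y \<in> carrier G"
  shows "x \<otimes> y \<in> Units G \<longleftrightarrow> x \<in> Units G \<and> y \<in> Units G"
proof
  assume u: "x \<otimes> y \<in> Units G"
  define z where "z = y \<otimes> inv (x \<otimes> y)"
  have z: "z \<in> carrier G"
    using u y by (simp add: z_def)
  have r: "x \<otimes> z = \<one>"
    using m_assoc[of x y "inv (x \<otimes> y)"] u x y by (simp add: z_def)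
  then have "x \<otimes> (z \<otimes> x) = x \<otimes> \<one>"
    using m_assoc[of x z x] x z by simp
  then have "z \<otimes> x = \<one>"
    using x z by (simp only: l_cancel m_closed one_closed)
  then have "x \<in> Units G"
    using r x z unfolding Units_def by blast
  then show "x \<in> Units G \<and> y \<in> Units G"
    using prod_unit_r u x y prod_unit_l by blast
qed simp

lemma (in monoid) atom_factorization_append:
  assumes "atom_factorization G as x" "atom_factorization G bs y"
  shows "atom_factorization G (as @ bs) (x \<otimes> y)"
proof -
  \<comment> \<open>The induction runs over bare products because its base case is the empty list,
    which is no factorization.\<close>
  have "foldr (\<otimes>) (cs @ bs) \<one> = foldr (\<otimes>) cs \<one> \<otimes> foldr (\<otimes>) bs \<one>" if "set cs \<subseteq> carrier G" for cs
    using that assms(2)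
    by (induction cs) (auto simp: m_assoc atom_factorization_def atom_def subset_iff)
  moreover have "set as \<subseteq> carrier G"
    using assms(1) by (auto simp: atom_factorization_def atom_def)
  ultimately show ?thesis
    using assms by (auto simp: atom_factorization_def)
qed

text \<open>A nonempty factorization of \<open>x\<close> joined to a longest one of \<open>y\<close>
  gives a strictly longer one of the product. Both orders are needed, one for each kind of principal
  ideal.\<close>

lemma (in monoid_cancel) Max_lengths_mult_less:
  assumes BFM: "BFM G" and x: "x \<in> carrier G" "x \<notin> Units G" and y: "y \<in> carrier G"
  shows "Max (lengths G y) < Max (lengths G (x \<otimes> y))"
    and "Max (lengths G y) < Max (lengths G (y \<otimes> x))"
proof -
  \<comment> \<open>Finiteness and nonemptiness make \<open>Max\<close> a genuine maximum, attained
    by some factorization.\<close>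
  have fin: "finite (lengths G z)" and ne: "lengths G z \<noteq> {}" if "z \<in> carrier G" for z
    using BFM that by (auto simp: BFM_def atomic_monoid_def lengths_def)
  have nonunit: "x \<otimes> y \<notin> Units G" "y \<otimes> x \<notin> Units G"
    using x y by (simp_all add: Units_mult_iff)
  obtain as where as: "atom_factorization G as x"
    using BFM x by (auto simp: BFM_def atomic_monoid_def)
  have "Max (lengths G y) < Max (lengths G (x \<otimes> y)) \<and> Max (lengths G y) < Max (lengths G (y \<otimes> x))"
  proof (cases "y \<in> Units G")
    case True
    \<comment> \<open>A unit has length set {0} by convention and no list to extend, but both
      products are non-units, whose lengths are positive.\<close>
    have "0 < Max (lengths G z)" if z: "z \<in> carrier G" "z \<notin> Units G" for z
      using Max_in[OF fin[OF z(1)] ne[OF z(1)]] z(2) by (auto simp: lengths_def atom_factorization_def)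
    then show ?thesis
      using True x y nonunit by (simp add: lengths_def[of G y])
  next
    case False
    then obtain bs where bs: "atom_factorization G bs y" "Max (lengths G y) = length bs"
      using Max_in[OF fin[OF y] ne[OF y]] by (auto simp: lengths_def)
    have "length (as @ bs) \<in> lengths G (x \<otimes> y)" "length (bs @ as) \<in> lengths G (y \<otimes> x)"
      using atom_factorization_append[OF as bs(1)] atom_factorization_append[OF bs(1) as] nonunit
      by (auto simp: lengths_def simp del: length_append)
    then have "length (as @ bs) \<le> Max (lengths G (x \<otimes> y))" "length (bs @ as) \<le> Max (lengths G (y \<otimes> x))"
      using fin x(1) y by simp_all
    moreover have "0 < length as"
      using as by (simp add: atom_factorization_def)
    ultimately show ?thesis
      using bs(2) by (simp del: length_greater_0_conv)
  qed
  then show "Max (lengths G y) < Max (lengths G (x \<otimes> y))"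
    and "Max (lengths G y) < Max (lengths G (y \<otimes> x))"
    by simp_all
qed

theorem (in monoid_cancel) BFM_imp_ACCP:
  assumes BFM: "BFM G"
  shows "ACCP G"
  unfolding ACCP_def
proof (intro conjI allI impI)
  fix x :: "nat \<Rightarrow> 'a"
  assume "\<forall>k. x k \<in> carrier G"
    and chain: "\<forall>k. carrier G #> x k \<subseteq> carrier G #> x (Suc k)"
  then have xc: "x k \<in> carrier G" for k by simp
  have "\<exists>N. \<forall>k. Max (lengths G (x N)) \<le> Max (lengths G (x k))"
    using ex_has_least_nat[of "\<lambda>_. True" "0::nat" "\<lambda>k. Max (lengths G (x k))"] by simp
  then obtain N where N: "\<And>k. Max (lengths G (x N)) \<le> Max (lengths G (x k))"
    by blast
  have "carrier G #> x k = carrier G #> x N" if "N \<le> k" for k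
  proof
    show "carrier G #> x N \<subseteq> carrier G #> x k"
      by (rule lift_Suc_mono_le[of "\<lambda>k. carrier G #> x k", OF chain[rule_format] that])
    \<comment> \<open>Membership of the generator itself in the larger ideal yields the cofactor
      \<open>m\<close>.\<close>
    moreover have "x N \<in> carrier G #> x N"
      using xc[of N] unfolding r_coset_def by (auto intro!: bexI[of _ "\<one>"])
    ultimately obtain m where m: "m \<in> carrier G" "x N = m \<otimes> x k"
      unfolding r_coset_def by blast
    \<comment> \<open>For a non-unit \<open>m\<close>, the maximal length of
      \<open>x N = m \<otimes> x k\<close> would exceed that of \<open>x k\<close>, against the
      choice of \<open>N\<close>.\<close>
    have u: "m \<in> Units G"
      using Max_lengths_mult_less[OF BFM m(1) _ xc[of k]] N[of k] m(2) by fastforce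
    have "z \<otimes> x k = (z \<otimes> inv m) \<otimes> x N" if "z \<in> carrier G" for z
      using m_assoc[of z "inv m" m] m_assoc[of "z \<otimes> inv m" m "x k"] u xc[of k] that m by simp
    moreover have "z \<otimes> inv m \<in> carrier G" if "z \<in> carrier G" for z
      using u that by simp
    ultimately show "carrier G #> x k \<subseteq> carrier G #> x N"
      unfolding r_coset_def by blast
  qed
  then show "\<exists>N. \<forall>k\<ge>N. carrier G #> x k = carrier G #> x N" by blast
next
  fix x :: "nat \<Rightarrow> 'a"
  assume "\<forall>k. x k \<in> carrier G"
    and chain: "\<forall>k. x k <# carrier G \<subseteq> x (Suc k) <# carrier G"
  then have xc: "x k \<in> carrier G" for k by simp
  have "\<exists>N. \<forall>k. Max (lengths G (x N)) \<le> Max (lengths G (x k))"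
    using ex_has_least_nat[of "\<lambda>_. True" "0::nat" "\<lambda>k. Max (lengths G (x k))"] by simp
  then obtain N where N: "\<And>k. Max (lengths G (x N)) \<le> Max (lengths G (x k))"
    by blast
  have "x k <# carrier G = x N <# carrier G" if "N \<le> k" for k
  proof
    show "x N <# carrier G \<subseteq> x k <# carrier G"
      by (rule lift_Suc_mono_le[of "\<lambda>k. x k <# carrier G", OF chain[rule_format] that])
    moreover have "x N \<in> x N <# carrier G"
      using xc[of N] unfolding l_coset_def by (auto intro!: bexI[of _ "\<one>"])
    ultimately obtain m where m: "m \<in> carrier G" "x N = x k \<otimes> m"
      unfolding l_coset_def by blast
    have u: "m \<in> Units G"
      using Max_lengths_mult_less[OF BFM m(1) _ xc[of k]] N[of k] m(2) by fastforce
    \<comment> \<open>Since \<open>m\<close> is a unit, \<open>x k\<close> is \<open>x N\<close>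
      times \<open>inv m\<close> on the right, which gives the reverse inclusion.\<close>
    have "x k \<otimes> z = x N \<otimes> (inv m \<otimes> z)" if "z \<in> carrier G" for z
      using m_assoc[of m "inv m" z] m_assoc[of "x k" m "inv m \<otimes> z"] u xc[of k] that m by simp
    moreover have "inv m \<otimes> z \<in> carrier G" if "z \<in> carrier G" for z
      using u that by simp
    ultimately show "x k <# carrier G \<subseteq> x N <# carrier G"
      unfolding l_coset_def by blast
  qed
  then show "\<exists>N. \<forall>k\<ge>N. x k <# carrier G = x N <# carrier G" by blast
qed

theorem corollary4p11:
  fixes n :: nat
  assumes "n \<ge> 2"
    and "BFM (unitriangular_monoid n :: 'a::reduced_information_semialgebra mat monoid)"
  shows "ACCP (unitriangular_monoid n :: 'a mat monoid)"
  \<comment> \<open>Additive cancellation in the semialgebra makes the matrix monoid cancellative,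
    so the general implication applies.\<close>
  by (rule monoid_cancel.BFM_imp_ACCP[OF monoid_cancel_unitriangular assms(2)])

end
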